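(* Let $(X_t)_{t\ge 0}$ be a norm process on a probability space $(\Omega,\mathcal{F},\mathbb{P})$. Then for $\mathbb{P}$-almost every $\omega\in\Omega$ the following holds: for every $v=(v_1,v_2)\in\mathbb{R}^2_{+,\ge}\setminus\{(0,0)\}$ there is a unique $p\in[\|v\|_\infty,\|v\|_1]$ such that $$\frac{v_1}{p}+X_{v_2/p}(\omega)=1 .$$ Moreover, denoting this unique number by $p(\omega,v)$, the function $p:\Omega\times(\mathbb{R}^2_{+,\ge}\setminus\{(0,0)\})\to[0,\infty)$ so obtained (defined for $\mathbb{P}$-almost every $\omega\in\Omega$), extended to the zero vector by $p(\omega,0):=0$, is a gauge invariant symmetric random norm (on $\mathbb{C}^2$, given by its restriction to $\mathbb{R}^2_{+,\ge}$).
   Context: $\mathbb{R}^n_{+,\ge}:=\{(x_1,\dots,x_n)\in\mathbb{R}^n : x_1\ge x_2\ge\dots\ge x_n\ge 0\}$. As usual $\|v\|_\infty=\max_i|v_i|$ and $\|v\|_1=\sum_i|v_i|$. A norm $\|\cdot\|$ on $\mathbb{C}^n$ is gauge invariant if $\|x\|=\|\,|x|\,\|$ for all $x\in\mathbb{C}^n$, where $|x|$ is the vector of element-wise absolute values. It is symmetric if $\|x\circ\pi\|=\|x\|$ for all $x\in\mathbb{C}^n$ and all permutations $\pi\in S_n$ of the coordinates. All norms considered are normalized so that the norm of $(1,0,\dots,0)$ equals $1$. A gauge invariant symmetric norm is determined by its restriction to $\mathbb{R}^n_{+,\ge}$. Accordingly, a function $q$ on $\mathbb{R}^n_{+,\ge}$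 is identified with the function $x\mapsto q(|x|^{\downarrow})$ on $\mathbb{C}^n$, where $|x|^{\downarrow}\in\mathbb{R}^n_{+,\ge}$ is the vector of absolute values of the coordinates of $x$ arranged in decreasing order. A function on $\mathbb{R}^n_{+,\ge}$ is said to define a symmetric gauge invariant norm if this extension is one. A gauge invariant symmetric random norm (GSRN) on a probability space $(\Omega,\mathcal{F},\mathbb{P})$ is a function $p:\Omega\times\mathbb{C}^n\to[0,\infty)$ such that (i) for $\mathbb{P}$-almost every $\omega\in\Omega$, $p(\omega,\cdot):\mathbb{C}^n\to[0,\infty)$ is a symmetric gauge invariant norm (normalized so that $p(\omega,(1,0,\dots,0))=1$); (ii) for every $x\in\mathbb{C}^n$, $p(\cdot,x):\Omega\to[0,\infty)$ is a random variable. Here functions defined only for $\mathbb{P}$-almost every $\omega$ are allowed, as usual. A real valued stochastic process $(X_t)_{t\ge0}$ is a norm process if $\mathbb{P}$-almost surely its realizations satisfy: (i) $X_0=0$; (ii) $0\le\frac{X_{t_2}-X_{t_1}}{t_2-t_1}\le 1$ for all $0\le t_1<t_2$; (iii) $t\mapsto X_t$ is convex and continuous. *)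

theory Defs
  imports "HOL-Probability.Probability"
begin

definition is_norm :: "(complex ^ 'n \<Rightarrow> real) \<Rightarrow> bool" where
  "is_norm N \<longleftrightarrow>
     (\<forall>x. 0 \<le> N x) \<and>
     (\<forall>x. N x = 0 \<longleftrightarrow> x = 0) \<and>
     (\<forall>c x. N (c *s x) = cmod c * N x) \<and>
     (\<forall>x y. N (x + y) \<le> N x + N y)"

definition gauge_invariant :: "(complex ^ 'n \<Rightarrow> real) \<Rightarrow> bool" where
  "gauge_invariant N \<longleftrightarrow> (\<forall>x. N x = N (\<chi> i. complex_of_real (cmod (x $ i))))"

definition symmetric :: "(complex ^ 'n \<Rightarrow> real) \<Rightarrow> bool" where
  "symmetric N \<longleftrightarrow> (\<forall>x \<pi>. \<pi> permutes UNIV \<longrightarrow> N (\<chi> i. x $ \<pi> i) = N x)"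

text \<open>Index \<open>1\<close> is the first coordinate (the convention of \<^const>\<open>vector\<close>), so
  \<open>axis 1 1\<close> is the vector \<open>(1, 0, \<dots>, 0)\<close>.\<close>

definition normalized :: "(complex ^ 'n::{finite, one} \<Rightarrow> real) \<Rightarrow> bool" where
  "normalized N \<longleftrightarrow> N (axis 1 1) = 1"

definition sym_gauge_norm :: "(complex ^ 'n::{finite, one} \<Rightarrow> real) \<Rightarrow> bool" where
  "sym_gauge_norm N \<longleftrightarrow> is_norm N \<and> gauge_invariant N \<and> symmetric N \<and> normalized N"

text \<open>A random norm may be defined only almost everywhere. The event \<open>D\<close> of full measure
  is where \<open>p\<close> counts as defined; the values of the HOL function \<open>p\<close> outside \<open>D\<close> are
  junk, so measurability is required on \<open>D\<close> only. For a random norm that is defined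
  everywhere, \<open>D = space M\<close>.\<close>

definition gsrn :: "'w measure \<Rightarrow> ('w \<Rightarrow> complex ^ 'n::{finite, one} \<Rightarrow> real) \<Rightarrow> bool" where
  "gsrn M p \<longleftrightarrow>
     (\<exists>D \<in> sets M.
        (AE \<omega> in M. \<omega> \<in> D) \<and>
        (\<forall>\<omega>\<in>D. \<forall>x. 0 \<le> p \<omega> x) \<and>
        (AE \<omega> in M. sym_gauge_norm (p \<omega>)) \<and>
        (\<forall>x. (\<lambda>\<omega>. p \<omega> x) \<in> borel_measurable (restrict_space M D)))"

definition norm_process :: "'w measure \<Rightarrow> (real \<Rightarrow> 'w \<Rightarrow> real) \<Rightarrow> bool" where
  "norm_process M X \<longleftrightarrow>
     (\<forall>t\<ge>0. X t \<in> borel_measurable M) \<and>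
     (AE \<omega> in M.
        X 0 \<omega> = 0 \<and>
        (\<forall>t1 t2. 0 \<le> t1 \<and> t1 < t2 \<longrightarrow>
           0 \<le> (X t2 \<omega> - X t1 \<omega>) / (t2 - t1) \<and> (X t2 \<omega> - X t1 \<omega>) / (t2 - t1) \<le> 1) \<and>
        convex_on {0..} (\<lambda>t. X t \<omega>) \<and>
        continuous_on {0..} (\<lambda>t. X t \<omega>))"

definition decreasing_cone :: "(real ^ 2) set" where
  "decreasing_cone = {v. v $ 1 \<ge> v $ 2 \<and> v $ 2 \<ge> 0}"

definition decreasing_abs :: "complex ^ 2 \<Rightarrow> real ^ 2" where
  "decreasing_abs x = vector (rev (sort [cmod (x $ 1), cmod (x $ 2)]))"

text \<open>The identification of a function on the cone with a function on all of \<open>\<complex>\<^sup>2\<close>.\<close>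

definition cone_extension :: "(real ^ 2 \<Rightarrow> real) \<Rightarrow> complex ^ 2 \<Rightarrow> real" where
  "cone_extension q x = q (decreasing_abs x)"

definition l1_norm :: "real ^ 'n \<Rightarrow> real" where
  "l1_norm v = (\<Sum>i\<in>UNIV. \<bar>v $ i\<bar>)"

definition process_norm :: "(real \<Rightarrow> 'w \<Rightarrow> real) \<Rightarrow> 'w \<Rightarrow> real ^ 2 \<Rightarrow> real" where
  "process_norm X \<omega> v =
     (if v = 0 then 0
      else (THE p. p \<in> {infnorm v..l1_norm v} \<and> v $ 1 / p + X (v $ 2 / p) \<omega> = 1))"

end

theory Submission
  imports Defs
begin

text \<open>For a path \<open>f\<close> of the process put \<open>H s t = max (s + f t) (t + f s)\<close>. The function \<open>H\<close> is
  convex and increasing in both arguments, and the slope bound gives \<open>H s t = s + f t\<close> whenever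
  \<open>s \<ge> t\<close>. Hence the solution \<open>p\<close> of the defining equation is the Minkowski functional of the convex
  set \<open>{H \<le> 1}\<close>: for \<open>c > 0\<close>, \<open>p \<le> c\<close> holds iff \<open>H (v\<^sub>1/c) (v\<^sub>2/c) \<le> 1\<close>. This yields
  the triangle inequality by convexity, and measurability in \<open>\<omega>\<close>.\<close>

section \<open>Coordinates, norms and sorting in dimension two\<close>

lemma infnorm_vec_2: "infnorm (v :: real ^ 2) = max \<bar>v $ 1\<bar> \<bar>v $ 2\<bar>"
proof -
  have *: "(Basis :: (real ^ 2) set) = {axis 1 1, axis 2 1}"
    unfolding Basis_vec_def by (auto simp: UNIV_2)
  show ?thesis
    by (simp add: infnorm_Max * inner_axis)
qed

lemma vec_2_eq_0_iff: "(v :: 'a::zero ^ 2) = 0 \<longleftrightarrow> v $ 1 = 0 \<and> v $ 2 = 0"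
  by (simp add: vec_eq_iff forall_2)

lemma decreasing_abs_nth [simp]:
  "decreasing_abs x $ 1 = max (cmod (x $ 1)) (cmod (x $ 2))"
  "decreasing_abs x $ 2 = min (cmod (x $ 1)) (cmod (x $ 2))"
  by (auto simp: decreasing_abs_def)

lemma decreasing_abs_in_cone: "decreasing_abs x \<in> decreasing_cone"
  by (auto simp: decreasing_cone_def)

lemma decreasing_abs_eq_0_iff: "decreasing_abs x = 0 \<longleftrightarrow> x = 0"
  by (auto simp: vec_2_eq_0_iff max_def min_def)

text \<open>Almost every \<open>\<omega>\<close> of a norm process satisfies these assumptions.
  Everything except measurability is deterministic and is proved for one such
  \<open>\<omega>\<close>.\<close>

locale norm_path =
  fixes X :: "real \<Rightarrow> 'w \<Rightarrow> real" and \<omega> :: 'w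
  assumes X_0: "X 0 \<omega> = 0"
    and X_slope: "\<And>s t. 0 \<le> s \<Longrightarrow> s < t \<Longrightarrow>
      0 \<le> (X t \<omega> - X s \<omega>) / (t - s) \<and> (X t \<omega> - X s \<omega>) / (t - s) \<le> 1"
    and X_convex: "convex_on {0..} (\<lambda>t. X t \<omega>)"
    and X_continuous: "continuous_on {0..} (\<lambda>t. X t \<omega>)"
begin

section \<open>The defining equation along a single path\<close>

lemma X_mono: "0 \<le> s \<Longrightarrow> s \<le> t \<Longrightarrow> X s \<omega> \<le> X t \<omega>"
  using X_slope[of s t] by (cases "s = t") (auto simp: zero_le_divide_iff)

lemma X_diff_le: "0 \<le> s \<Longrightarrow> s \<le> t \<Longrightarrow> X t \<omega> - X s \<omega> \<le> t - s"
  using X_slope[of s t] by (cases "s = t") (auto simp: divide_le_eq_1)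

lemma X_nonneg: "0 \<le> t \<Longrightarrow> 0 \<le> X t \<omega>"
  using X_mono[of 0 t] X_0 by simp

text \<open>The first summand decreases strictly because \<open>a > 0\<close>, and the second cannot
  increase because the path is monotone. This is the source of uniqueness and of the sublevel
  criterion below.\<close>

lemma level_strict_decreasing:
  assumes "0 < a" "0 \<le> b" "0 < p" "p < q"
  shows "a / q + X (b / q) \<omega> < a / p + X (b / p) \<omega>"
proof -
  have "a / q < a / p" "b / q \<le> b / p"
    using assms by (simp_all add: frac_less2 frac_le)
  then show ?thesis
    using X_mono[of "b / q" "b / p"] assms by simp
qed

text \<open>The intermediate value theorem applies between the two norms: at \<open>p = a\<close>
  the left side is at least 1 since \<open>X\<close> is nonnegative, and at \<open>p = a + b\<close>
  it is at most 1 since \<open>X t \<le> t\<close>. Strict decrease in \<open>p\<close> gives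
  uniqueness.\<close>

lemma ex1_level:
  assumes "v \<in> decreasing_cone - {0}"
  shows "\<exists>!p. p \<in> {infnorm v..l1_norm v} \<and> v $ 1 / p + X (v $ 2 / p) \<omega> = 1"
proof -
  define a b where "a = v $ 1" and "b = v $ 2"
  have ab: "0 < a" "0 \<le> b" "b \<le> a"
    using assms by (auto simp: decreasing_cone_def vec_2_eq_0_iff a_def b_def)
  have norms: "infnorm v = a" "l1_norm v = a + b"
    using ab by (auto simp: infnorm_vec_2 l1_norm_def sum_2 a_def b_def)
  have "\<exists>p\<ge>a. p \<le> a + b \<and> a / p + X (b / p) \<omega> = 1"
  proof (rule IVT2')
    have "X (b / (a + b)) \<omega> \<le> b / (a + b)"
      using X_diff_le[of 0 "b / (a + b)"] X_0 ab by simp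
    moreover have "a / (a + b) + b / (a + b) = 1"
      using ab by (simp flip: add_divide_distrib)
    ultimately show "a / (a + b) + X (b / (a + b)) \<omega> \<le> 1"
      by linarith
    show "1 \<le> a / a + X (b / a) \<omega>"
      using X_nonneg[of "b / a"] ab by simp
    show "continuous_on {a..a + b} (\<lambda>p. a / p + X (b / p) \<omega>)"
      by (intro continuous_intros continuous_on_compose2[OF X_continuous]) (use ab in auto)
  qed (use ab in simp)
  then obtain p where p: "a \<le> p" "p \<le> a + b" "a / p + X (b / p) \<omega> = 1"
    by blast
  have unique: "q = p" if "a \<le> q" "a / q + X (b / q) \<omega> = 1" for q
    using level_strict_decreasing[of a b p q] level_strict_decreasing[of a b q p] p that ab
    by (cases p q rule: linorder_cases) auto
  show ?thesis
    unfolding norms a_def[symmetric] b_def[symmetric] atLeastAtMost_iff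
    using p unique by blast
qed

lemma process_norm_solves:
  assumes "v \<in> decreasing_cone - {0}"
  shows "process_norm X \<omega> v \<in> {infnorm v..l1_norm v}"
    and "v $ 1 / process_norm X \<omega> v + X (v $ 2 / process_norm X \<omega> v) \<omega> = 1"
  using theI'[OF ex1_level[OF assms]] assms by (auto simp: process_norm_def)

lemma process_norm_pos: "v \<in> decreasing_cone - {0} \<Longrightarrow> 0 < process_norm X \<omega> v"
  using process_norm_solves(1)[of v]
  by (metis Diff_iff atLeastAtMost_iff infnorm_pos_lt insertI1 less_le_trans)

text \<open>Strict decrease turns the implicit equation into an inequality at the known value
  \<open>c\<close>. At \<open>v = 0\<close> both sides hold, by the convention for the zero vector
  and by \<open>X_0\<close>.\<close>

lemma process_norm_le_iff:
  assumes v: "v \<in> decreasing_cone" and c: "0 < c"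
  shows "process_norm X \<omega> v \<le> c \<longleftrightarrow> v $ 1 / c + X (v $ 2 / c) \<omega> \<le> 1"
proof (cases "v = 0")
  case True
  then show ?thesis
    using c by (simp add: process_norm_def X_0)
next
  case False
  let ?p = "process_norm X \<omega> v"
  have v': "v \<in> decreasing_cone - {0}" and ab: "0 < v $ 1" "0 \<le> v $ 2"
    using v False by (auto simp: decreasing_cone_def vec_2_eq_0_iff)
  show ?thesis
    using level_strict_decreasing[OF ab, of ?p c] level_strict_decreasing[OF ab, of c ?p]
      process_norm_solves(2)[OF v'] process_norm_pos[OF v'] c
    by (cases ?p c rule: linorder_cases) auto
qed

section \<open>The extension to complex vectors is a norm\<close>

abbreviation N :: "complex ^ 2 \<Rightarrow> real" where
  "N \<equiv> cone_extension (process_norm X \<omega>)"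

lemma N_0 [simp]: "N 0 = 0"
  using decreasing_abs_eq_0_iff[of 0] by (simp add: cone_extension_def process_norm_def)

lemma N_pos: "x \<noteq> 0 \<Longrightarrow> 0 < N x"
  unfolding cone_extension_def
  by (rule process_norm_pos) (simp add: decreasing_abs_in_cone decreasing_abs_eq_0_iff)

lemma N_nonneg: "0 \<le> N x"
  using N_pos[of x] by (cases "x = 0") auto

text \<open>By the slope bound, the inequality with the larger modulus outside \<open>X\<close>
  implies the one with the roles exchanged. Requiring both therefore removes the sorting, which is
  not compatible with addition of vectors.\<close>

lemma N_le_iff:
  assumes "0 < c"
  shows "N x \<le> c \<longleftrightarrow>
    cmod (x $ 1) / c + X (cmod (x $ 2) / c) \<omega> \<le> 1 \<and>
    cmod (x $ 2) / c + X (cmod (x $ 1) / c) \<omega> \<le> 1"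
proof -
  have le: "t / c + X (s / c) \<omega> \<le> s / c + X (t / c) \<omega>" if "0 \<le> t" "t \<le> s" for s t
    using X_diff_le[of "t / c" "s / c"] that assms by (simp add: divide_right_mono)
  have "N x \<le> c \<longleftrightarrow> max (cmod (x $ 1)) (cmod (x $ 2)) / c
      + X (min (cmod (x $ 1)) (cmod (x $ 2)) / c) \<omega> \<le> 1"
    using process_norm_le_iff[OF decreasing_abs_in_cone assms] by (simp add: cone_extension_def)
  then show ?thesis
    using le[of "cmod (x $ 1)" "cmod (x $ 2)"] le[of "cmod (x $ 2)" "cmod (x $ 1)"]
    by (cases "cmod (x $ 1)" "cmod (x $ 2)" rule: linorder_le_cases) (auto simp: max_def min_def)
qed

lemma N_scale: "N (c *s x) = cmod c * N x"
proof -
  have le: "N (c *s x) \<le> cmod c * N x" for c x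
  proof (cases "c = 0 \<or> x = 0")
    case False
    then have "0 < cmod c" "0 < N x"
      using N_pos by auto
    then show ?thesis
      using N_le_iff[of "cmod c * N x" "c *s x"] N_le_iff[of "N x" x]
      by (simp add: norm_mult)
  qed auto
  show ?thesis
  proof (cases "c = 0")
    case False
    \<comment> \<open>The reverse inequality is the first one applied to the scalar
      \<open>inverse c\<close> and the vector \<open>c *s x\<close>.\<close>
    have "N x = N (inverse c *s (c *s x))"
      using False by (simp add: vector_smult_assoc)
    also have "\<dots> \<le> cmod (inverse c) * N (c *s x)"
      by (rule le)
    finally have "cmod c * N x \<le> N (c *s x)"
      using False by (simp add: norm_divide field_simps)
    with le[of c x] show ?thesis
      by simp
  qed simp
qed

text \<open>Dividing by \<open>p + q\<close> makes the sum a convex combination of the points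
  rescaled by \<open>p\<close> and by \<open>q\<close>, with weights \<open>p / (p + q)\<close> and
  \<open>q / (p + q)\<close>. The slack variables \<open>u\<close> and \<open>w\<close> receive the
  moduli of the coordinates of a sum of vectors.\<close>

lemma level_convex:
  assumes "0 \<le> s" "0 \<le> t" "0 \<le> s'" "0 \<le> t'" "0 < p" "0 < q"
    and "0 \<le> u" "u \<le> s + s'" "0 \<le> w" "w \<le> t + t'"
    and "s / p + X (t / p) \<omega> \<le> 1" "s' / q + X (t' / q) \<omega> \<le> 1"
  shows "u / (p + q) + X (w / (p + q)) \<omega> \<le> 1"
proof -
  define l where "l = q / (p + q)"
  have l: "0 \<le> l" "l \<le> 1" "1 - l = p / (p + q)"
    using assms by (auto simp: l_def field_simps)
  have comb: "(y + y') / (p + q) = (1 - l) * (y / p) + l * (y' / q)" for y y'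
    unfolding l(3) using assms by (simp add: l_def add_divide_distrib)
  have "X (w / (p + q)) \<omega> \<le> X ((t + t') / (p + q)) \<omega>"
    using assms by (intro X_mono divide_right_mono) auto
  also have "\<dots> \<le> (1 - l) * X (t / p) \<omega> + l * X (t' / q) \<omega>"
    using convex_onD[OF X_convex l(1,2), of "t / p" "t' / q"] assms by (simp add: comb)
  finally have "u / (p + q) + X (w / (p + q)) \<omega> \<le>
      (s + s') / (p + q) + ((1 - l) * X (t / p) \<omega> + l * X (t' / q) \<omega>)"
    using assms by (intro add_mono divide_right_mono) auto
  also have "\<dots> = (1 - l) * (s / p + X (t / p) \<omega>) + l * (s' / q + X (t' / q) \<omega>)"
    by (simp add: comb algebra_simps)
  also have "\<dots> \<le> 1"
    using assms(11,12) l by (intro convex_bound_le) auto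
  finally show ?thesis .
qed

lemma N_triangle: "N (x + y) \<le> N x + N y"
proof (cases "x = 0 \<or> y = 0")
  case False
  then have pos: "0 < N x" "0 < N y"
    using N_pos by auto
  have lx: "cmod (x $ 1) / N x + X (cmod (x $ 2) / N x) \<omega> \<le> 1"
      "cmod (x $ 2) / N x + X (cmod (x $ 1) / N x) \<omega> \<le> 1"
    using N_le_iff[OF pos(1), of x] by simp_all
  have ly: "cmod (y $ 1) / N y + X (cmod (y $ 2) / N y) \<omega> \<le> 1"
      "cmod (y $ 2) / N y + X (cmod (y $ 1) / N y) \<omega> \<le> 1"
    using N_le_iff[OF pos(2), of y] by simp_all
  have tri: "cmod ((x + y) $ i) \<le> cmod (x $ i) + cmod (y $ i)" for i
    by (simp add: norm_triangle_ineq)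
  \<comment> \<open>The coordinate indices stay schematic, so that one fact serves both orders of
    the coordinates.\<close>
  note level = level_convex[OF norm_ge_zero norm_ge_zero norm_ge_zero norm_ge_zero pos
      norm_ge_zero tri norm_ge_zero tri]
  from level[OF lx(1) ly(1)] level[OF lx(2) ly(2)] show ?thesis
    using N_le_iff[of "N x + N y" "x + y"] pos by linarith
qed auto

lemma sym_gauge_norm_N: "sym_gauge_norm N"
  unfolding sym_gauge_norm_def
proof (intro conjI)
  show "is_norm N"
    unfolding is_norm_def using N_nonneg N_pos N_scale N_triangle
    by (metis N_0 less_irrefl)
  show "gauge_invariant N"
    by (simp add: gauge_invariant_def cone_extension_def decreasing_abs_def)
  show "symmetric N"
    unfolding symmetric_def
  proof (intro allI impI)
    fix x :: "complex ^ 2" and \<pi> :: "2 \<Rightarrow> 2"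
    assume "\<pi> permutes UNIV"
    then have "inj \<pi>"
      by (rule permutes_inj)
    then have "\<pi> 1 \<noteq> \<pi> 2"
      by (simp add: inj_eq)
    then have "\<pi> 1 = 1 \<and> \<pi> 2 = 2 \<or> \<pi> 1 = 2 \<and> \<pi> 2 = 1"
      using exhaust_2 by metis
    then have "decreasing_abs (\<chi> i. x $ \<pi> i) = decreasing_abs x"
      by (auto simp: decreasing_abs_def)
    then show "N (\<chi> i. x $ \<pi> i) = N x"
      by (simp add: cone_extension_def)
  qed
  let ?e = "axis 1 1 :: complex ^ 2"
  have e: "decreasing_abs ?e \<in> decreasing_cone - {0}"
    by (simp add: decreasing_abs_in_cone decreasing_abs_eq_0_iff)
  show "normalized N"
    \<comment> \<open>The sorted vector is (1, 0), so the equation reads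
      \<open>1 / p + X 0 \<omega> = 1\<close> and forces \<open>p = 1\<close>.\<close>
    using process_norm_solves(2)[OF e]
    by (simp add: normalized_def cone_extension_def axis_def X_0)
qed

end

section \<open>From single paths to almost every path, and measurability\<close>

theorem theorem1:
  fixes M :: "'w measure" and X :: "real \<Rightarrow> 'w \<Rightarrow> real"
  assumes "prob_space M"
    and "norm_process M X"
  shows "(AE \<omega> in M. \<forall>v \<in> decreasing_cone - {0}.
            \<exists>!p. p \<in> {infnorm v..l1_norm v} \<and> v $ 1 / p + X (v $ 2 / p) \<omega> = 1)
       \<and> gsrn M (\<lambda>\<omega>. cone_extension (process_norm X \<omega>))"
proof
  have AE_path: "AE \<omega> in M. norm_path X \<omega>"
    using conjunct2[OF assms(2)[unfolded norm_process_def]]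
    by eventually_elim (rule norm_path.intro; elim conjE; simp)
  have X_measurable: "X t \<in> borel_measurable M" if "0 \<le> t" for t
    using assms(2) that by (simp add: norm_process_def)
  show "AE \<omega> in M. \<forall>v \<in> decreasing_cone - {0}.
      \<exists>!p. p \<in> {infnorm v..l1_norm v} \<and> v $ 1 / p + X (v $ 2 / p) \<omega> = 1"
    using AE_path by eventually_elim (intro ballI norm_path.ex1_level)
  from AE_path obtain Z where Z: "{\<omega> \<in> space M. \<not> norm_path X \<omega>} \<subseteq> Z" "Z \<in> null_sets M"
    by (auto simp: eventually_ae_filter)
  \<comment> \<open>The set of regular paths need not be measurable, so \<open>D\<close> is the
    complement of a measurable null set covering the exceptions.\<close>
  define D where "D = space M - Z"
  have D: "D \<in> sets M" "AE \<omega> in M. \<omega> \<in> D" "\<And>\<omega>. \<omega> \<in> D \<Longrightarrow> norm_path X \<omega>"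
    using Z AE_not_in[OF Z(2)] by (auto simp: D_def)
  have "(\<lambda>\<omega>. cone_extension (process_norm X \<omega>) x) \<in> borel_measurable (restrict_space M D)" for x
  proof (subst borel_measurable_iff_le, intro allI)
    fix c :: real
    let ?R = "restrict_space M D" and ?v = "decreasing_abs x"
    have R: "space ?R = D"
      using sets.sets_into_space[OF D(1)] by (auto simp: space_restrict_space)
    have v: "?v \<in> decreasing_cone" "0 \<le> ?v $ 2"
      using decreasing_abs_in_cone by auto
    consider "0 < c" | "c \<le> 0" "x \<noteq> 0" | "c \<le> 0" "x = 0"
      by linarith
    then show "{\<omega> \<in> space ?R. cone_extension (process_norm X \<omega>) x \<le> c} \<in> sets ?R"
    proof cases
      case 1
      \<comment> \<open>The time \<open>?v $ 2 / c\<close> does not depend on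
        \<open>\<omega>\<close>, so the sublevel set is an event about a single random variable of
        the process.\<close>
      have "{\<omega> \<in> space ?R. cone_extension (process_norm X \<omega>) x \<le> c} =
          {\<omega> \<in> space ?R. ?v $ 1 / c + X (?v $ 2 / c) \<omega> \<le> 1}"
        using norm_path.process_norm_le_iff[OF D(3) v(1) 1] by (auto simp: R cone_extension_def)
      moreover have "X (?v $ 2 / c) \<in> borel_measurable ?R"
        using 1 v by (intro measurable_restrict_space1 X_measurable) simp
      ultimately show ?thesis
        by simp
    next
      case 2
      \<comment> \<open>The norm of a nonzero vector is positive on all of \<open>D\<close>.\<close>
      then have "{\<omega> \<in> space ?R. cone_extension (process_norm X \<omega>) x \<le> c} = {}"
        using norm_path.N_pos[OF D(3)] by (fastforce simp: R)
      then show ?thesis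
        by (simp only: sets.empty_sets)
    next
      case 3
      then have "{\<omega> \<in> space ?R. cone_extension (process_norm X \<omega>) x \<le> c} =
          {\<omega> \<in> space ?R. 0 \<le> c}"
        using norm_path.N_0[OF D(3)] by (auto simp: R)
      then show ?thesis
        by simp
    qed
  qed
  moreover have "AE \<omega> in M. sym_gauge_norm (cone_extension (process_norm X \<omega>))"
    using AE_path by eventually_elim (rule norm_path.sym_gauge_norm_N)
  ultimately show "gsrn M (\<lambda>\<omega>. cone_extension (process_norm X \<omega>))"
    unfolding gsrn_def using D norm_path.N_nonneg[OF D(3)] by blast
qed

end
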